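(* For integers $n\ge 0$ and $k\ge 0$, let $s(n,k)$ denote the number of maximal independent sets of size exactly $k$ in the square cactus $S(n)$. Then, as formal power series in $x,y$, $$\sum_{n\ge 0}\sum_{k\ge 0} s(n,k)\,x^n y^k \;=\; \frac{1-2xy+2xy^2-2x^2y^3+x^2y^2+x^2y^4}{1-2xy+x^2y^2-x^2y^3}.$$
   Context: For $n\ge 1$, the square (ortho-rectangular) cactus $S(n)$ is the graph formed by a chain of $n$ 4-cycles $B_1,\dots,B_n$, where for each $1\le i\le n-1$ the consecutive cycles $B_i$ and $B_{i+1}$ share exactly one vertex, non-consecutive cycles share no vertex, every vertex lies in at most two cycles, and for each $2\le i\le n-1$ the two shared (cut) vertices of $B_i$ are adjacent. $S(0)$ is the empty graph, so $s(0,0)=1$ and $s(0,k)=0$ for $k\ge1$. An independent set is maximal if no further vertex can be added while keeping it independent. *)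

theory Defs
  imports "HOL-Computational_Algebra.Formal_Power_Series"
begin

text \<open>A finite simple graph is given by a vertex set and a set of two-element vertex sets.\<close>

definition four_cycle :: "'a set \<Rightarrow> 'a set set \<Rightarrow> bool" where
  "four_cycle W F \<longleftrightarrow>
     (\<exists>a b c d. distinct [a, b, c, d] \<and> W = {a, b, c, d} \<and> F = {{a, b}, {b, c}, {c, d}, {d, a}})"

text \<open>The cycle \<open>B\<^sub>i\<close> has vertex set \<open>W i\<close> and edge set \<open>F i\<close>; only the indices \<open>1, \<dots>, n\<close> matter.\<close>

definition square_cactus :: "nat \<Rightarrow> 'a set \<Rightarrow> 'a set set \<Rightarrow> bool" where
  "square_cactus n V E \<longleftrightarrow>
     (\<exists>W F. (\<forall>i\<in>{1..n}. four_cycle (W i) (F i)) \<and>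
        V = (\<Union>i\<in>{1..n}. W i) \<and> E = (\<Union>i\<in>{1..n}. F i) \<and>
        (\<forall>i. 1 \<le> i \<and> i < n \<longrightarrow> card (W i \<inter> W (i + 1)) = 1) \<and>
        (\<forall>i j. 1 \<le> i \<and> i + 1 < j \<and> j \<le> n \<longrightarrow> W i \<inter> W j = {}) \<and>
        (\<forall>v\<in>V. card {i\<in>{1..n}. v \<in> W i} \<le> 2) \<and>
        (\<forall>i. 2 \<le> i \<and> i < n \<longrightarrow>
           (\<forall>u\<in>W (i - 1) \<inter> W i. \<forall>v\<in>W i \<inter> W (i + 1). {u, v} \<in> E)))"

definition independent_set :: "'a set \<Rightarrow> 'a set set \<Rightarrow> 'a set \<Rightarrow> bool" where
  "independent_set V E I \<longleftrightarrow> I \<subseteq> V \<and> (\<forall>u\<in>I. \<forall>v\<in>I. {u, v} \<notin> E)"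

definition maximal_independent_set :: "'a set \<Rightarrow> 'a set set \<Rightarrow> 'a set \<Rightarrow> bool" where
  "maximal_independent_set V E I \<longleftrightarrow>
     independent_set V E I \<and> (\<forall>v\<in>V - I. \<not> independent_set V E (insert v I))"

definition num_maximal_independent_sets :: "'a set \<Rightarrow> 'a set set \<Rightarrow> nat \<Rightarrow> nat" where
  "num_maximal_independent_sets V E k = card {I. maximal_independent_set V E I \<and> card I = k}"

lemma square_cactus_0_iff: "square_cactus 0 V E \<longleftrightarrow> V = {} \<and> E = {}"
  by (simp add: square_cactus_def)

lemma num_maximal_independent_sets_empty:
  "num_maximal_independent_sets {} {} k = (if k = 0 then 1 else 0)"
proof -
  have "{I. maximal_independent_set ({}::'a set) {} I \<and> card I = k} = (if k = 0 then {{}} else {})"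
    by (auto simp: maximal_independent_set_def independent_set_def)
  then show ?thesis
    by (simp add: num_maximal_independent_sets_def)
qed

text \<open>The axioms of \<open>square_cactus\<close> are satisfiable for every length.\<close>

lemma square_cactus_exists: "\<exists>V E. square_cactus n (V :: nat set) E"
proof -
  define W where "W i = {3*i - 3, 3*i, 3*i - 1, 3*i - (2::nat)}" for i
  define F where "F i = {{3*i - 3, 3*i}, {3*i, 3*i - 1}, {3*i - 1, 3*i - 2}, {3*i - 2, 3*i - (3::nat)}}" for i
  have W_iff: "v \<in> W i \<longleftrightarrow> 3*i - 3 \<le> v \<and> v \<le> 3*i" if "1 \<le> i" for i v
    using that by (auto simp: W_def)
  have cyc: "four_cycle (W i) (F i)" if "1 \<le> i" for i
    unfolding four_cycle_def W_def F_def
    by (rule exI[of _ "3*i - 3"], rule exI[of _ "3*i"], rule exI[of _ "3*i - 1"],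
        rule exI[of _ "3*i - 2"]) (use that in auto)
  have meet: "W i \<inter> W (i + 1) = {3*i}" if "1 \<le> i" for i
    using that by (auto simp: W_iff)
  have disj: "W i \<inter> W j = {}" if "1 \<le> i" "i + 1 < j" for i j
    using that by (auto simp: W_iff)
  have two: "card {i\<in>{1..n}. v \<in> W i} \<le> 2" for v
  proof -
    have "{i\<in>{1..n}. v \<in> W i} \<subseteq> {(v + 2) div 3, v div 3 + 1}"
      by (auto simp: W_iff)
    then have "card {i\<in>{1..n}. v \<in> W i} \<le> card {(v + 2) div 3, v div 3 + 1}"
      by (intro card_mono) auto
    also have "\<dots> \<le> 2" by (simp add: card_insert_if)
    finally show ?thesis .
  qed
  have adj: "{u, v} \<in> F i" if "2 \<le> i" "u \<in> W (i - 1) \<inter> W i" "v \<in> W i \<inter> W (i + 1)" for i u v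
  proof -
    have "W (i - 1) \<inter> W i = {3*i - 3}"
      using meet[of "i - 1"] \<open>2 \<le> i\<close> by (simp add: diff_mult_distrib2)
    then have "u = 3*i - 3" using that by blast
    moreover have "v = 3*i" using that meet[of i] by auto
    ultimately show ?thesis by (simp add: F_def)
  qed
  have "square_cactus n (\<Union>i\<in>{1..n}. W i) (\<Union>i\<in>{1..n}. F i)"
    unfolding square_cactus_def
  proof (intro exI[of _ W] exI[of _ F] conjI ballI allI impI refl)
    fix i u v assume "2 \<le> i \<and> i < n" "u \<in> W (i - 1) \<inter> W i" "v \<in> W i \<inter> W (i + 1)"
    then show "{u, v} \<in> (\<Union>i\<in>{1..n}. F i)"
      using adj[of i u v] by (intro UN_I[of i]) auto
  qed (use cyc meet disj two in auto)
  then show ?thesis by blast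
qed

text \<open>
  A power series in \<open>x\<close> and \<open>y\<close> is a series in \<open>x\<close> whose coefficients are series in \<open>y\<close>,
  so \<open>x\<close> is \<open>fps_X\<close> and \<open>y\<close> is \<open>fps_const fps_X\<close>. Division by a series \<open>D\<close> is genuine
  division when its coefficient at \<open>x\<^sup>0\<close> is \<open>1\<close>:
\<close>

lemma fps_fps_divide_unit:
  fixes D N P :: "rat fps fps"
  assumes "fps_nth D 0 = 1"
  shows "P = N / D \<longleftrightarrow> D * P = N"
proof -
  have one: "inverse (1 :: rat fps) = 1"
    using inverse_mult_eq_1[of "1 :: rat fps"] by simp
  have "D * fps_right_inverse D 1 = 1"
    by (rule fps_right_inverse) (simp add: assms)
  moreover have "inverse D = fps_right_inverse D (inverse (fps_nth D 0))"
    by (simp only: fps_inverse_def)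
  ultimately have inv: "D * inverse D = 1"
    by (simp only: assms one)
  have "subdegree D = 0" "D \<noteq> 0" using assms by auto
  then have div: "N / D = N * inverse D"
    by (simp add: fps_divide_def)
  show ?thesis
  proof
    assume "P = N / D"
    then have "D * P = N * (D * inverse D)" by (simp add: div mult_ac)
    then show "D * P = N" by (simp add: inv)
  next
    assume "D * P = N"
    then have "N / D = P * (D * inverse D)" by (simp add: div mult_ac)
    then show "P = N / D" by (simp add: inv)
  qed
qed

end

theory Submission imports Defs begin

text \<open>
  Build the cactus one cycle at a time, keeping track of a root vertex at which the next cycle is
  attached, and count the independent sets that dominate every vertex other than the root. Sort
  them by the state of the root: chosen (\<open>A\<close>), not chosen but dominated (\<open>B\<close>), not dominated (\<open>C\<close>).
  Attaching a cycle \<open>r - a - c - b - r\<close> at the root \<open>r\<close> and moving the root to \<open>a\<close> gives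
  \<open>A' = y\<^sup>2 (B + C)\<close>, \<open>B' = y (A + B)\<close>, \<open>C' = y (B + C)\<close>, starting from a single vertex with
  \<open>A = y\<close>, \<open>B = 0\<close>, \<open>C = 1\<close>. Hence \<open>A = y C\<close> throughout, and \<open>A + B\<close>, which counts the maximal
  independent sets, satisfies the linear recurrence encoded by the denominator. The single vertex
  contributes \<open>y\<close> at \<open>x\<^sup>0\<close> where the empty graph contributes \<open>1\<close>, which accounts for the numerator.
\<close>

definition dominated :: "'a set set \<Rightarrow> 'a set \<Rightarrow> 'a \<Rightarrow> bool" where
  "dominated E I v \<longleftrightarrow> (\<exists>u\<in>I. {u, v} \<in> E)"

definition near_maximal :: "'a set \<Rightarrow> 'a set set \<Rightarrow> 'a \<Rightarrow> 'a set \<Rightarrow> bool" where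
  "near_maximal V E r I \<longleftrightarrow> independent_set V E I \<and> (\<forall>v\<in>V - I - {r}. dominated E I v)"

definition root_in :: "'a set \<Rightarrow> 'a set set \<Rightarrow> 'a \<Rightarrow> 'a set set" where
  "root_in V E r = {I. near_maximal V E r I \<and> r \<in> I}"

definition root_dominated :: "'a set \<Rightarrow> 'a set set \<Rightarrow> 'a \<Rightarrow> 'a set set" where
  "root_dominated V E r = {I. near_maximal V E r I \<and> r \<notin> I \<and> dominated E I r}"

definition root_free :: "'a set \<Rightarrow> 'a set set \<Rightarrow> 'a \<Rightarrow> 'a set set" where
  "root_free V E r = {I. near_maximal V E r I \<and> r \<notin> I \<and> \<not> dominated E I r}"

lemmas root_defs = root_in_def root_dominated_def root_free_def

inductive rooted_cactus :: "nat \<Rightarrow> 'a set \<Rightarrow> 'a set set \<Rightarrow> 'a \<Rightarrow> bool" where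
  vertex: "rooted_cactus 0 {r} {} r"
| attach: "rooted_cactus n V E r \<Longrightarrow> distinct [a, b, c] \<Longrightarrow> {a, b, c} \<inter> V = {} \<Longrightarrow>
    rooted_cactus (Suc n) (V \<union> {a, b, c}) (E \<union> {{r, a}, {a, c}, {c, b}, {b, r}}) a"

lemma rooted_cactus_graph:
  assumes "rooted_cactus n V E r"
  shows "finite V \<and> r \<in> V \<and> E \<subseteq> Pow V \<and> (\<forall>v. {v} \<notin> E)"
  using assms by induction auto

lemma maximal_independent_set_iff:
  assumes "\<forall>v. {v} \<notin> E"
  shows "maximal_independent_set V E I \<longleftrightarrow>
    independent_set V E I \<and> (\<forall>v\<in>V - I. dominated E I v)"
proof -
  have "\<not> independent_set V E (insert v I) \<longleftrightarrow> dominated E I v"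
    if "independent_set V E I" "v \<in> V - I" for v
    using that assms by (auto simp: independent_set_def dominated_def insert_commute)
  then show ?thesis
    unfolding maximal_independent_set_def by blast
qed

lemma maximal_independent_sets_eq:
  assumes "\<forall>v. {v} \<notin> E" "r \<in> V"
  shows "{I. maximal_independent_set V E I} = root_in V E r \<union> root_dominated V E r"
  using assms by (auto simp: maximal_independent_set_iff root_defs near_maximal_def)

lemma near_maximal_attach_iff:
  assumes r: "r \<in> V" and E: "E \<subseteq> Pow V"
    and d: "distinct [a, b, c]" and fresh: "{a, b, c} \<inter> V = {}"
    and J: "J \<subseteq> V" and K: "K \<subseteq> {a, b, c}"
  defines "E' \<equiv> E \<union> {{r, a}, {a, c}, {c, b}, {b, r}}"
  shows "near_maximal (V \<union> {a, b, c}) E' a (J \<union> K) \<longleftrightarrow>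
    near_maximal V E r J \<and>
    (r \<in> J \<longrightarrow> a \<notin> K \<and> b \<notin> K) \<and> (c \<in> K \<longrightarrow> a \<notin> K \<and> b \<notin> K) \<and>
    (b \<notin> K \<longrightarrow> r \<in> J \<or> c \<in> K) \<and> (c \<notin> K \<longrightarrow> a \<in> K \<or> b \<in> K) \<and>
    (r \<notin> J \<longrightarrow> a \<in> K \<or> b \<in> K \<or> dominated E J r)"
    (is "_ \<longleftrightarrow> ?R")
    and "dominated E' (J \<union> K) a \<longleftrightarrow> r \<in> J \<or> c \<in> K"
proof -
  have new: "a \<notin> V" "b \<notin> V" "c \<notin> V" "a \<noteq> b" "a \<noteq> c" "b \<noteq> c"
    using d fresh by auto
  then have ne: "r \<noteq> a" "r \<noteq> b" "r \<noteq> c" using r by auto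
  have old: "{u, v} \<in> E \<Longrightarrow> u \<in> V \<and> v \<in> V" for u v
    using E by auto
  have Ea: "{u, a} \<in> E' \<longleftrightarrow> u = r \<or> u = c" for u
    using new ne old[of u a] by (auto simp: E'_def doubleton_eq_iff)
  have Eb: "{u, b} \<in> E' \<longleftrightarrow> u = r \<or> u = c" for u
    using new ne old[of u b] by (auto simp: E'_def doubleton_eq_iff)
  have Ec: "{u, c} \<in> E' \<longleftrightarrow> u = a \<or> u = b" for u
    using new ne old[of u c] by (auto simp: E'_def doubleton_eq_iff)
  have EV: "{u, v} \<in> E' \<longleftrightarrow> {u, v} \<in> E" if "u \<in> V" "v \<in> V" for u v
    using new ne that by (auto simp: E'_def doubleton_eq_iff)
  have JK: "a \<notin> J" "b \<notin> J" "c \<notin> J" "r \<notin> K" "K \<inter> V = {}"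
    using new ne J K r by auto
  have dom_a: "dominated E' (J \<union> K) a \<longleftrightarrow> r \<in> J \<or> c \<in> K"
    using JK by (auto simp: dominated_def Ea)
  have dom_b: "dominated E' (J \<union> K) b \<longleftrightarrow> r \<in> J \<or> c \<in> K"
    using JK by (auto simp: dominated_def Eb)
  have dom_c: "dominated E' (J \<union> K) c \<longleftrightarrow> a \<in> K \<or> b \<in> K"
    using JK by (auto simp: dominated_def Ec)
  have cross: "{u, v} \<in> E' \<longleftrightarrow> v = r \<and> (u = a \<or> u = b)" if "u \<in> K" "v \<in> V" for u v
  proof -
    have "u = a \<or> u = b \<or> u = c" using that K by auto
    then show ?thesis
      using Ea[of v] Eb[of v] Ec[of v] that new by (auto simp: insert_commute)
  qed
  have dom_V: "dominated E' (J \<union> K) v \<longleftrightarrow> dominated E J v \<or> v = r \<and> (a \<in> K \<or> b \<in> K)"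
    if v: "v \<in> V" for v
  proof -
    have "(\<exists>u\<in>J. {u, v} \<in> E') \<longleftrightarrow> (\<exists>u\<in>J. {u, v} \<in> E)"
      using EV[OF _ v] J by blast
    moreover have "(\<exists>u\<in>K. {u, v} \<in> E') \<longleftrightarrow> v = r \<and> (a \<in> K \<or> b \<in> K)"
      using cross[OF _ v] by blast
    ultimately show ?thesis by (simp add: dominated_def bex_Un)
  qed
  have KK: "(\<forall>u\<in>K. \<forall>v\<in>K. {u, v} \<notin> E') \<longleftrightarrow> (c \<in> K \<longrightarrow> a \<notin> K \<and> b \<notin> K)"
  proof -
    have "{u, v} \<in> E' \<longleftrightarrow> (u = c \<and> (v = a \<or> v = b)) \<or> (v = c \<and> (u = a \<or> u = b))"
      if "u \<in> K" "v \<in> K" for u v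
    proof -
      have "v = a \<or> v = b \<or> v = c" using that K by auto
      then show ?thesis
        using that Ea[of u] Eb[of u] Ec[of u] new JK(4) by auto
    qed
    then show ?thesis by blast
  qed
  have JK_adj: "(\<forall>u\<in>K. \<forall>v\<in>J. {u, v} \<notin> E') \<longleftrightarrow> (r \<in> J \<longrightarrow> a \<notin> K \<and> b \<notin> K)"
    using cross J by blast
  have JJ: "(\<forall>u\<in>J. \<forall>v\<in>J. {u, v} \<notin> E') \<longleftrightarrow> (\<forall>u\<in>J. \<forall>v\<in>J. {u, v} \<notin> E)"
    using EV J by blast
  have "independent_set (V \<union> {a, b, c}) E' (J \<union> K) \<longleftrightarrow>
    (\<forall>u\<in>J. \<forall>v\<in>J. {u, v} \<notin> E') \<and> (\<forall>u\<in>K. \<forall>v\<in>J. {u, v} \<notin> E') \<and> (\<forall>u\<in>K. \<forall>v\<in>K. {u, v} \<notin> E')"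
  proof -
    have "(\<forall>u\<in>J. \<forall>v\<in>K. {u, v} \<notin> E') \<longleftrightarrow> (\<forall>u\<in>K. \<forall>v\<in>J. {u, v} \<notin> E')"
      by (metis insert_commute)
    then show ?thesis
      using J K unfolding independent_set_def ball_Un by blast
  qed
  then have indep: "independent_set (V \<union> {a, b, c}) E' (J \<union> K) \<longleftrightarrow>
    independent_set V E J \<and> (r \<in> J \<longrightarrow> a \<notin> K \<and> b \<notin> K) \<and> (c \<in> K \<longrightarrow> a \<notin> K \<and> b \<notin> K)"
    using J by (simp only: JJ JK_adj KK) (simp add: independent_set_def)
  have "(V \<union> {a, b, c}) - (J \<union> K) - {a} = (V - J) \<union> ({b, c} - K)"
    using new JK by auto
  then have "(\<forall>v\<in>(V \<union> {a, b, c}) - (J \<union> K) - {a}. dominated E' (J \<union> K) v) \<longleftrightarrow>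
    (\<forall>v\<in>V - J. dominated E' (J \<union> K) v) \<and>
    (b \<notin> K \<longrightarrow> r \<in> J \<or> c \<in> K) \<and> (c \<notin> K \<longrightarrow> a \<in> K \<or> b \<in> K)"
    using dom_b dom_c by (simp only: ball_Un) auto
  moreover have "(\<forall>v\<in>V - J. dominated E' (J \<union> K) v) \<longleftrightarrow>
    (\<forall>v\<in>V - J - {r}. dominated E J v) \<and>
    (r \<notin> J \<longrightarrow> a \<in> K \<or> b \<in> K \<or> dominated E J r)"
    using dom_V r by auto
  ultimately show "near_maximal (V \<union> {a, b, c}) E' a (J \<union> K) \<longleftrightarrow> ?R"
    using indep unfolding near_maximal_def by blast
  show "dominated E' (J \<union> K) a \<longleftrightarrow> r \<in> J \<or> c \<in> K" by (rule dom_a)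
qed

lemma root_classes_subset:
  "root_in V E r \<subseteq> Pow V" "root_dominated V E r \<subseteq> Pow V" "root_free V E r \<subseteq> Pow V"
  by (auto simp: root_defs near_maximal_def independent_set_def)

lemma
  assumes r: "r \<in> V" and E: "E \<subseteq> Pow V"
    and d: "distinct [a, b, c]" and fresh: "{a, b, c} \<inter> V = {}"
  defines "V' \<equiv> V \<union> {a, b, c}" and "E' \<equiv> E \<union> {{r, a}, {a, c}, {c, b}, {b, r}}"
  shows root_in_attach:
      "root_in V' E' a = (\<lambda>J. J \<union> {a, b}) ` (root_dominated V E r \<union> root_free V E r)" (is ?A)
    and root_dominated_attach:
      "root_dominated V' E' a = (\<lambda>J. J \<union> {c}) ` (root_in V E r \<union> root_dominated V E r)" (is ?B)
    and root_free_attach: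
      "root_free V' E' a = (\<lambda>J. J \<union> {b}) ` (root_dominated V E r \<union> root_free V E r)" (is ?C)
proof -
  note iff = near_maximal_attach_iff[OF r E d fresh, folded V'_def E'_def]
  have new: "a \<notin> V" "b \<notin> V" "c \<notin> V" "a \<noteq> b" "a \<noteq> c" "b \<noteq> c"
    using d fresh by auto
  have image: "S = (\<lambda>J. J \<union> K) ` T"
    if ST: "S \<subseteq> Pow V'" "T \<subseteq> Pow V" and K: "K \<subseteq> {a, b, c}"
      and eq: "\<And>J L. J \<subseteq> V \<Longrightarrow> L \<subseteq> {a, b, c} \<Longrightarrow> J \<union> L \<in> S \<longleftrightarrow> J \<in> T \<and> L = K" for S T K
  proof
    show "S \<subseteq> (\<lambda>J. J \<union> K) ` T"
    proof
      fix I assume I: "I \<in> S"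
      then have "I = (I \<inter> V) \<union> (I \<inter> {a, b, c})" using ST by (auto simp: V'_def)
      then show "I \<in> (\<lambda>J. J \<union> K) ` T"
        using eq[of "I \<inter> V" "I \<inter> {a, b, c}"] I by (metis Int_lower2 image_eqI)
    qed
    show "(\<lambda>J. J \<union> K) ` T \<subseteq> S"
      using eq ST K by auto
  qed
  have sub: "L = K \<longleftrightarrow> (a \<in> L \<longleftrightarrow> a \<in> K) \<and> (b \<in> L \<longleftrightarrow> b \<in> K) \<and> (c \<in> L \<longleftrightarrow> c \<in> K)"
    if "L \<subseteq> {a, b, c}" "K \<subseteq> {a, b, c}" for L K
    using that by blast
  have mem: "a \<in> J \<union> L \<longleftrightarrow> a \<in> L" if "J \<subseteq> V" for J L
    using that new by auto
  show ?A
  proof (rule image)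
    fix J L assume JL: "J \<subseteq> V" "L \<subseteq> {a, b, c}"
    show "J \<union> L \<in> root_in V' E' a \<longleftrightarrow> J \<in> root_dominated V E r \<union> root_free V E r \<and> L = {a, b}"
      using new by (simp add: root_defs iff[OF JL] mem[OF JL(1)] sub[OF JL(2)] del: Un_iff) auto
  qed (simp_all add: root_classes_subset)
  show ?B
  proof (rule image)
    fix J L assume JL: "J \<subseteq> V" "L \<subseteq> {a, b, c}"
    show "J \<union> L \<in> root_dominated V' E' a \<longleftrightarrow>
        J \<in> root_in V E r \<union> root_dominated V E r \<and> L = {c}"
      using new by (simp add: root_defs iff[OF JL] mem[OF JL(1)] sub[OF JL(2)] del: Un_iff) auto
  qed (simp_all add: root_classes_subset)
  show ?C
  proof (rule image)
    fix J L assume JL: "J \<subseteq> V" "L \<subseteq> {a, b, c}"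
    show "J \<union> L \<in> root_free V' E' a \<longleftrightarrow> J \<in> root_dominated V E r \<union> root_free V E r \<and> L = {b}"
      using new by (simp add: root_defs iff[OF JL] mem[OF JL(1)] sub[OF JL(2)] del: Un_iff) auto
  qed (simp_all add: root_classes_subset)
qed

definition size_gf :: "'a set set \<Rightarrow> rat fps" where
  "size_gf S = (\<Sum>I\<in>S. fps_X ^ card I)"

lemma size_gf_nth:
  assumes "finite S"
  shows "fps_nth (size_gf S) k = of_nat (card {I\<in>S. card I = k})"
proof -
  have "fps_nth (size_gf S) k = (\<Sum>I\<in>S. if card I = k then 1 else 0)"
    unfolding size_gf_def fps_sum_nth by (intro sum.cong) (auto simp: fps_X_power_nth)
  also have "\<dots> = of_nat (card {I\<in>S. card I = k})"
    using assms by (simp add: sum.If_cases Int_def)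
  finally show ?thesis .
qed

lemma size_gf_disjoint_union:
  assumes "finite S" "finite T" "S \<inter> T = {}"
  shows "size_gf (S \<union> T) = size_gf S + size_gf T"
  using assms unfolding size_gf_def by (rule sum.union_disjoint)

lemma size_gf_image_union:
  assumes "S \<subseteq> Pow V" "finite V" "finite K" "K \<inter> V = {}"
  shows "size_gf ((\<lambda>J. J \<union> K) ` S) = fps_X ^ card K * size_gf S"
proof -
  have inj: "inj_on (\<lambda>J. J \<union> K) S"
    using assms by (intro inj_onI) blast
  have "card (J \<union> K) = card K + card J" if "J \<in> S" for J
    using that assms by (subst card_Un_disjoint) (auto intro: finite_subset)
  then show ?thesis
    unfolding size_gf_def by (simp add: sum.reindex[OF inj] sum_distrib_left power_add)
qed

text \<open>The generating functions of \<open>root_dominated\<close> and \<open>root_free\<close>, in this order.\<close>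

fun root_gf :: "nat \<Rightarrow> rat fps \<times> rat fps" where
  "root_gf 0 = (0, 1)"
| "root_gf (Suc n) =
    (let (p, q) = root_gf n in (fps_X * (fps_X * q + p), fps_X * (p + q)))"

lemma root_gf_correct:
  assumes "rooted_cactus n V E r"
  shows "size_gf (root_in V E r) = fps_X * snd (root_gf n) \<and>
    size_gf (root_dominated V E r) = fst (root_gf n) \<and>
    size_gf (root_free V E r) = snd (root_gf n)"
  using assms
proof induction
  case (vertex r)
  have "root_in {r} {} r = {{r}}" "root_dominated {r} {} r = {}" "root_free {r} {} r = {{}}"
    by (auto simp: root_defs near_maximal_def independent_set_def dominated_def)
  then show ?case by (simp add: size_gf_def)
next
  case (attach n V E r a b c)
  have graph: "finite V" "r \<in> V" "E \<subseteq> Pow V"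
    using rooted_cactus_graph[OF attach.hyps(1)] by auto
  have new: "a \<notin> V" "b \<notin> V" "c \<notin> V" "a \<noteq> b"
    using attach.hyps by auto
  note step = root_in_attach[OF graph(2,3) attach.hyps(2,3)]
    root_dominated_attach[OF graph(2,3) attach.hyps(2,3)]
    root_free_attach[OF graph(2,3) attach.hyps(2,3)]
  have fin: "finite (root_in V E r)" "finite (root_dominated V E r)" "finite (root_free V E r)"
    using root_classes_subset[of V E r] graph(1) by (auto intro: finite_subset[of _ "Pow V"])
  have disj: "root_dominated V E r \<inter> root_free V E r = {}"
      "root_in V E r \<inter> root_dominated V E r = {}"
    by (auto simp: root_defs)
  have sub: "root_dominated V E r \<union> root_free V E r \<subseteq> Pow V"
      "root_in V E r \<union> root_dominated V E r \<subseteq> Pow V"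
    using root_classes_subset[of V E r] by auto
  show ?case
    using new attach.IH unfolding step
    by (simp add: size_gf_image_union[OF sub(1) graph(1)] size_gf_image_union[OF sub(2) graph(1)]
        size_gf_disjoint_union fin disj case_prod_beta power2_eq_square mult.assoc del: Un_insert_right)
qed

lemma four_cycle_neighbour:
  assumes "four_cycle W F" "r \<in> W"
  shows "\<exists>a. {r, a} \<in> F"
  using assms unfolding four_cycle_def by blast

lemma four_cycle_subset: "four_cycle W F \<Longrightarrow> F \<subseteq> Pow W"
  unfolding four_cycle_def by auto

lemma four_cycle_through_edge:
  assumes "four_cycle W F" "{r, a} \<in> F"
  shows "\<exists>b c. distinct [r, a, b, c] \<and> W = {r, a, b, c} \<and> F = {{r, a}, {a, c}, {c, b}, {b, r}}"
proof -
  obtain p q s t where d: "distinct [p, q, s, t]" and W: "W = {p, q, s, t}"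
    and F: "F = {{p, q}, {q, s}, {s, t}, {t, p}}"
    using assms(1) unfolding four_cycle_def by blast
  have d': "distinct [t, s, q, p]" using d by auto
  consider "r = p" "a = q" | "r = q" "a = p" | "r = q" "a = s" | "r = s" "a = q"
    | "r = s" "a = t" | "r = t" "a = s" | "r = t" "a = p" | "r = p" "a = t"
    using assms(2) unfolding F by (auto simp: doubleton_eq_iff)
  then show ?thesis
  proof cases
    case 1 then show ?thesis
      using d d' W F by - (rule exI[of _ t], rule exI[of _ s], simp add: insert_commute)
  next
    case 2 then show ?thesis
      using d d' W F by - (rule exI[of _ s], rule exI[of _ t], simp add: insert_commute)
  next
    case 3 then show ?thesis
      using d d' W F by - (rule exI[of _ p], rule exI[of _ t], simp add: insert_commute)
  next
    case 4 then show ?thesis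
      using d d' W F by - (rule exI[of _ t], rule exI[of _ p], simp add: insert_commute)
  next
    case 5 then show ?thesis
      using d d' W F by - (rule exI[of _ q], rule exI[of _ p], simp add: insert_commute)
  next
    case 6 then show ?thesis
      using d d' W F by - (rule exI[of _ p], rule exI[of _ q], simp add: insert_commute)
  next
    case 7 then show ?thesis
      using d d' W F by - (rule exI[of _ s], rule exI[of _ q], simp add: insert_commute)
  next
    case 8 then show ?thesis
      using d d' W F by - (rule exI[of _ q], rule exI[of _ s], simp add: insert_commute)
  qed
qed

lemma square_cactus_rooted:
  assumes "square_cactus n V E" "n \<ge> 1"
  shows "\<exists>r. rooted_cactus n V E r"
proof -
  obtain W F where c: "\<forall>i\<in>{1..n}. four_cycle (W i) (F i)"
    and V: "V = (\<Union>i\<in>{1..n}. W i)" and E: "E = (\<Union>i\<in>{1..n}. F i)"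
    and m: "\<forall>i. 1 \<le> i \<and> i < n \<longrightarrow> card (W i \<inter> W (i + 1)) = 1"
    and f: "\<forall>i j. 1 \<le> i \<and> i + 1 < j \<and> j \<le> n \<longrightarrow> W i \<inter> W j = {}"
    and e: "\<forall>i. 2 \<le> i \<and> i < n \<longrightarrow>
      (\<forall>u\<in>W (i - 1) \<inter> W i. \<forall>v\<in>W i \<inter> W (i + 1). {u, v} \<in> E)"
    using assms(1) unfolding square_cactus_def by (elim exE conjE) (rule that)
  have cyc: "four_cycle (W i) (F i)" if "1 \<le> i" "i \<le> n" for i
    using c that by simp
  have far: "W i \<inter> W j = {}" if "1 \<le> i" "i + 1 < j" "j \<le> n" for i j
    using f that by simp
  have adj: "{u, v} \<in> E"
    if "2 \<le> i" "i < n" "u \<in> W (i - 1) \<inter> W i" "v \<in> W i \<inter> W (i + 1)" for i u v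
    using e that by blast
  have F_sub: "e \<subseteq> W i" if "e \<in> F i" "1 \<le> i" "i \<le> n" for e i
    using four_cycle_subset[OF cyc] that by blast
  have "\<forall>i. \<exists>v. 1 \<le> i \<and> i < n \<longrightarrow> W i \<inter> W (i + 1) = {v}"
    using m by (auto simp: card_1_singleton_iff)
  then obtain s where s: "\<And>i. 1 \<le> i \<Longrightarrow> i < n \<Longrightarrow> W i \<inter> W (i + 1) = {s i}"
    by metis
  have s_edge: "{s (i - 1), s i} \<in> F i" if i: "2 \<le> i" "i < n" for i
  proof -
    have u: "s (i - 1) \<in> W (i - 1) \<inter> W i" using s[of "i - 1"] i by auto
    have v: "s i \<in> W i \<inter> W (i + 1)" using s[of i] i by auto
    obtain j where j: "1 \<le> j" "j \<le> n" "{s (i - 1), s i} \<in> F j"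
      using adj[OF i u v] unfolding E by auto
    then have "s (i - 1) \<in> W j" "s i \<in> W j" using F_sub by blast+
    then have "\<not> i < j" "\<not> j < i"
      using far[of "i - 1" j] far[of j "i + 1"] i j u v by force+
    then show ?thesis using j by simp
  qed
  have "\<exists>u v. {u, v} \<in> F 1 \<and> (1 < n \<longrightarrow> v = s 1)"
  proof -
    have fc: "four_cycle (W 1) (F 1)" using cyc assms(2) by simp
    have "\<exists>v\<in>W 1. 1 < n \<longrightarrow> v = s 1"
      using s[of 1] fc unfolding four_cycle_def by (cases "1 < n") auto
    then show ?thesis
      using four_cycle_neighbour[OF fc] by (metis insert_commute)
  qed
  then obtain r0 v1 where r0: "{r0, v1} \<in> F 1" "1 < n \<longrightarrow> v1 = s 1" by blast
  have "\<exists>v. 1 < n \<longrightarrow> {s (n - 1), v} \<in> F n"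
  proof (cases "1 < n")
    case True
    then have "W (n - 1) \<inter> W n = {s (n - 1)}" using s[of "n - 1"] by (simp add: Suc_leI)
    then have "s (n - 1) \<in> W n" by blast
    then show ?thesis using four_cycle_neighbour[OF cyc, of n] assms(2) by blast
  qed simp
  then obtain vn where vn: "1 < n \<longrightarrow> {s (n - 1), vn} \<in> F n" by blast
  define r where "r i = (if i = 0 then r0 else if i < n then s i else if n = 1 then v1 else vn)" for i
  have r_edge: "{r i, r (Suc i)} \<in> F (Suc i)" if "i < n" for i
    using that s_edge[of "Suc i"] r0 vn unfolding r_def
    by (cases "i = 0"; cases "Suc i = n") auto
  have r_0: "r 0 \<in> W 1"
    using r_edge[of 0] F_sub[of "{r 0, r 1}" 1] assms(2) by simp
  have rooted: "rooted_cactus m ({r 0} \<union> (\<Union>i\<in>{1..m}. W i)) (\<Union>i\<in>{1..m}. F i) (r m)" if "m \<le> n" for m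
    using that
  proof (induction m)
    case 0
    show ?case by (simp add: rooted_cactus.vertex)
  next
    case (Suc m)
    have "four_cycle (W (Suc m)) (F (Suc m))" "{r m, r (Suc m)} \<in> F (Suc m)"
      using cyc r_edge Suc.prems by simp_all
    from four_cycle_through_edge[OF this] obtain b c where
      bc: "distinct [r m, r (Suc m), b, c]" "W (Suc m) = {r m, r (Suc m), b, c}"
        "F (Suc m) = {{r m, r (Suc m)}, {r (Suc m), c}, {c, b}, {b, r m}}"
      by blast
    let ?V = "{r 0} \<union> (\<Union>i\<in>{1..m}. W i)"
    have IH: "rooted_cactus m ?V (\<Union>i\<in>{1..m}. F i) (r m)"
      using Suc by simp
    have rm: "r m \<in> ?V"
      using rooted_cactus_graph[OF IH] by simp
    have "W (Suc m) \<inter> ?V \<subseteq> {r m}"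
    proof (cases "m = 0")
      case False
      have "?V = (\<Union>i\<in>{1..m}. W i)" using r_0 False by force
      moreover have "v = r m" if "v \<in> W (Suc m)" "v \<in> W i" "1 \<le> i" "i \<le> m" for v i
      proof -
        have "i = m" using far[of i "Suc m"] that Suc.prems by force
        then show ?thesis using s[of m] that Suc.prems False by (auto simp: r_def)
      qed
      ultimately show ?thesis by auto
    qed auto
    then have fresh: "{r (Suc m), b, c} \<inter> ?V = {}"
      using bc by auto
    have "?V \<union> {r (Suc m), b, c} = {r 0} \<union> (\<Union>i\<in>{1..Suc m}. W i)"
      using rm bc(2) by (auto simp: atLeastAtMostSuc_conv)
    moreover have "(\<Union>i\<in>{1..m}. F i) \<union> {{r m, r (Suc m)}, {r (Suc m), c}, {c, b}, {b, r m}}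
        = (\<Union>i\<in>{1..Suc m}. F i)"
      using bc(3) by (auto simp: atLeastAtMostSuc_conv)
    ultimately show ?case
      using rooted_cactus.attach[OF IH _ fresh] bc(1) by simp
  qed
  have "{r 0} \<union> (\<Union>i\<in>{1..n}. W i) = V" using r_0 assms(2) unfolding V by force
  then show ?thesis using rooted[of n] E by auto
qed

lemma maximal_independent_sets_gf:
  assumes "square_cactus n V E" "n \<ge> 1"
  shows "Abs_fps (\<lambda>k. of_nat (num_maximal_independent_sets V E k)) =
    fps_X * snd (root_gf n) + fst (root_gf n)"
proof -
  obtain r where r: "rooted_cactus n V E r"
    using square_cactus_rooted[OF assms] by blast
  note graph = rooted_cactus_graph[OF r]
  let ?S = "root_in V E r \<union> root_dominated V E r"
  have S: "{I. maximal_independent_set V E I} = ?S"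
    using graph by (intro maximal_independent_sets_eq) auto
  have fin: "finite (root_in V E r)" "finite (root_dominated V E r)"
    using root_classes_subset[of V E r] graph by (auto intro: finite_subset[of _ "Pow V"])
  have "{I. maximal_independent_set V E I \<and> card I = k} = {I\<in>?S. card I = k}" for k
    using S by blast
  then have "Abs_fps (\<lambda>k. of_nat (num_maximal_independent_sets V E k)) = size_gf ?S"
    using fin by (intro fps_ext) (simp add: size_gf_nth num_maximal_independent_sets_def)
  also have "\<dots> = size_gf (root_in V E r) + size_gf (root_dominated V E r)"
    using fin by (intro size_gf_disjoint_union) (auto simp: root_defs)
  finally show ?thesis
    using root_gf_correct[OF r] by simp
qed

theorem theorem2p7:
  fixes V :: "nat \<Rightarrow> 'a set" and E :: "nat \<Rightarrow> 'a set set"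
  assumes "\<And>n. square_cactus n (V n) (E n)"
  shows "(let x = (fps_X :: rat fps fps); y = fps_const (fps_X :: rat fps) in
     Abs_fps (\<lambda>n. Abs_fps (\<lambda>k. of_nat (num_maximal_independent_sets (V n) (E n) k))) =
       (1 - 2*x*y + 2*x*y^2 - 2*x^2*y^3 + x^2*y^2 + x^2*y^4) /
       (1 - 2*x*y + x^2*y^2 - x^2*y^3))"
proof -
  define x where "x = (fps_X :: rat fps fps)"
  define y where "y = fps_const (fps_X :: rat fps)"
  define P where
    "P = Abs_fps (\<lambda>n. Abs_fps (\<lambda>k. of_nat (num_maximal_independent_sets (V n) (E n) k)) :: rat fps)"
  define Q where "Q = Abs_fps (\<lambda>n. fps_X * snd (root_gf n) + fst (root_gf n))"
  define D where "D = 1 - 2*x*y + x^2*y^2 - x^2*y^3"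
  have D: "D = 1 - fps_const (2 * fps_X) * x + fps_const (fps_X^2 - fps_X^3) * x^2"
    by (simp add: D_def y_def algebra_simps flip: fps_const_power fps_const_sub fps_const_mult
        numeral_fps_const)
  have DQ: "D * Q = Q - fps_const (2 * fps_X) * (x * Q) + fps_const (fps_X^2 - fps_X^3) * (x^2 * Q)"
    unfolding D by algebra
  have "D * Q = y"
  proof (rule fps_ext)
    fix n
    have "fps_nth (D * Q) n = fps_nth Q n - 2 * fps_X * (if n = 0 then 0 else fps_nth Q (n - 1))
        + (fps_X^2 - fps_X^3) * (if n < 2 then 0 else fps_nth Q (n - 2))"
      unfolding DQ by (simp add: x_def fps_X_power_mult_nth)
    also have "\<dots> = fps_nth y n"
    proof -
      consider "n = 0" | "n = 1" | m where "n = Suc (Suc m)"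
        by (metis One_nat_def not0_implies_Suc)
      then show ?thesis
        by cases (simp_all add: Q_def y_def case_prod_beta algebra_simps power2_eq_square
            power3_eq_cube)
    qed
    finally show "fps_nth (D * Q) n = fps_nth y n" .
  qed
  have PQ: "P = Q + 1 - y"
  proof (rule fps_ext)
    fix n
    have "Abs_fps (\<lambda>k. of_nat (num_maximal_independent_sets (V 0) (E 0) k)) = (1 :: rat fps)"
      using assms[of 0] unfolding square_cactus_0_iff
      by (intro fps_ext) (simp add: num_maximal_independent_sets_empty)
    then show "fps_nth P n = fps_nth (Q + 1 - y) n"
      using maximal_independent_sets_gf[OF assms, of n]
      by (cases "n = 0") (simp_all add: P_def Q_def y_def)
  qed
  have "D * P = 1 - 2*x*y + 2*x*y^2 - 2*x^2*y^3 + x^2*y^2 + x^2*y^4"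
  proof -
    have "D * P = y + D * (1 - y)"
      using \<open>D * Q = y\<close> by (simp add: PQ algebra_simps)
    also have "\<dots> = 1 - 2*x*y + 2*x*y^2 - 2*x^2*y^3 + x^2*y^2 + x^2*y^4"
      unfolding D_def by algebra
    finally show ?thesis .
  qed
  moreover have "fps_nth D 0 = 1"
    by (simp add: D x_def)
  ultimately show ?thesis
    unfolding Let_def by (simp only: fps_fps_divide_unit D_def P_def x_def y_def)
qed

end
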